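(* Let $D$ be a diagram with nonempty columns $c_1<\cdots<c_n$, and suppose column $c_i$ of $D$ contains $n_i$ cells for $i\in[n]$. Then \[\max\{|\mathrm{empty}(\tilde D)| : \tilde D\in\mathrm{Min}(D)\}=\sum_{i=1}^n\bigl(h(D,c_i)-n_i\bigr).\]
   Context: A diagram is a finite subset $D\subset\mathbb{Z}_{>0}\times\mathbb{Z}_{>0}$; $(r,c)\in D$ is a cell in row $r$, column $c$. $\mathrm{empty}(D)=\{(r,c)\notin D : \exists\,\tilde r>r \text{ with } (\tilde r,c)\in D\}$. Kohnert move at row $r$: if row $r$ is empty, $\mathcal{K}(D,r)=D$; otherwise let $(r,c)$ be the rightmost cell of row $r$; if some $r'<r$ has $(r',c)\notin D$, take the largest such $r'$ and set $\mathcal{K}(D,r)=(D\setminus\{(r,c)\})\cup\{(r',c)\}$; else $\mathcal{K}(D,r)=D$. $\mathrm{KD}(D)$ is the set of diagrams obtainable from $D$ by finite sequences of Kohnert moves, and $\mathrm{Min}(D)=\{\tilde D\in\mathrm{KD}(D):\mathcal{K}(\tilde D,r)=\tilde D\ \forall r\}$. For a nonempty column $c$ of $D$: let $m_c$ be the number of cells in column $c$, $M$ the maximum number of cells in a column of $D$ strictly to the right of $c$ ($M=0$ if none), and $r$ the row of the topmost cell of column $c$ in $D$; define $h(D,c)=r$ if $M\ge r$, $h(D,c)=m_c$ if $m_c\ge M$, and $h(D,c)=M$ if $r>M>m_c$. *)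

theory Defs
  imports Main
begin

text \<open>A cell is a pair (row, column). Rows and columns are numbered from 1, and rows are
  numbered upwards, so Kohnert moves lower cells.\<close>

definition diagram :: "(nat \<times> nat) set \<Rightarrow> bool" where
  "diagram D \<longleftrightarrow> finite D \<and> D \<subseteq> {0<..} \<times> {0<..}"

definition col :: "(nat \<times> nat) set \<Rightarrow> nat \<Rightarrow> nat set" where
  "col D c = {r. (r, c) \<in> D}"

definition empty_cells :: "(nat \<times> nat) set \<Rightarrow> (nat \<times> nat) set" where
  "empty_cells D =
    {(r, c). 0 < r \<and> 0 < c \<and> (r, c) \<notin> D \<and> (\<exists>r'>r. (r', c) \<in> D)}"

definition kohnert_move :: "(nat \<times> nat) set \<Rightarrow> nat \<Rightarrow> (nat \<times> nat) set" where
  "kohnert_move D r =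
    (if {c. (r, c) \<in> D} = {} then D
     else let c = Max {c. (r, c) \<in> D};
              E = {r'. 0 < r' \<and> r' < r \<and> (r', c) \<notin> D}
          in if E = {} then D else (D - {(r, c)}) \<union> {(Max E, c)})"

inductive_set KD :: "(nat \<times> nat) set \<Rightarrow> (nat \<times> nat) set set"
  for D :: "(nat \<times> nat) set" where
  base: "D \<in> KD D"
| step: "D' \<in> KD D \<Longrightarrow> 0 < r \<Longrightarrow> kohnert_move D' r \<in> KD D"

definition Min_KD :: "(nat \<times> nat) set \<Rightarrow> (nat \<times> nat) set set" where
  "Min_KD D = {D' \<in> KD D. \<forall>r>0. kohnert_move D' r = D'}"

definition max_right :: "(nat \<times> nat) set \<Rightarrow> nat \<Rightarrow> nat" where
  "max_right D c = Max (insert 0 {card (col D c') | c'. c < c' \<and> col D c' \<noteq> {}})"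

text \<open>The cases in the definition of h can overlap only when all the quantities compared
  are equal, so their order is immaterial. The definition is meaningful for nonempty columns
  of a diagram; the last branch is the case r > M > m.\<close>

definition h :: "(nat \<times> nat) set \<Rightarrow> nat \<Rightarrow> nat" where
  "h D c =
    (let m = card (col D c); M = max_right D c; r = Max (col D c)
     in if r \<le> M then r else if M \<le> m then m else M)"

end

theory Submission
  imports Defs
begin

text \<open>In a nonempty column let \<open>m\<close> be the number of cells, \<open>r\<close> the row of the top cell, and \<open>M\<close> the
  largest number of cells in a column further right; then \<open>h = min r (max m M)\<close>. A column with
  top cell in row \<open>t\<close> contains \<open>t - m\<close> empty cells, and Kohnert moves preserve \<open>m\<close>, so the question
  is how high the top cells of a minimal diagram can be.

  Cells never rise, so \<open>t \<le> r\<close>. In a minimal diagram, the rightmost cell in the row of a top cell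
  lies on a full column, so \<open>t \<le> m\<close> or \<open>t \<le> M\<close>. Hence \<open>t \<le> h\<close>.

  Conversely, treat the columns from right to left and, in each of them, apply the Kohnert move to
  the top cell until that cell is in row \<open>h\<close>. Such a move lowers the top of the column by exactly
  one row, and it is available as long as \<open>t > h\<close>, since the columns further right reach at most
  row \<open>M\<close> by then. When all tops are in row \<open>h\<close>, the rightmost column with \<open>M\<close> cells is full and blocks
  rows \<open>1..M\<close>, while a column reaching above \<open>M\<close> is full itself. So the diagram is minimal.\<close>

section \<open>Columns as finite sets of positive rows\<close>

lemma mem_col [simp]: "r \<in> col D c \<longleftrightarrow> (r, c) \<in> D"
  by (simp add: col_def)

lemma finite_col: "diagram D \<Longrightarrow> finite (col D c)"
  unfolding diagram_def col_def
  by (rule finite_subset[where B = "fst ` D"]) force+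

lemma finite_row: "diagram D \<Longrightarrow> finite {c. (r, c) \<in> D}"
  unfolding diagram_def
  by (rule finite_subset[where B = "snd ` D"]) force+

lemma diagram_pos: "diagram D \<Longrightarrow> (r, c) \<in> D \<Longrightarrow> 0 < r \<and> 0 < c"
  by (auto simp: diagram_def)

lemma finite_nonempty_cols: "diagram D \<Longrightarrow> finite {c. col D c \<noteq> {}}"
  unfolding diagram_def col_def
  by (rule finite_subset[where B = "snd ` D"]) force+

lemma col_subset_atLeastAtMost_Max: "diagram D \<Longrightarrow> col D c \<subseteq> {1..Max (col D c)}"
  using finite_col[of D c] diagram_pos[of D] by (force simp: Suc_le_eq)

lemma card_col_le_Max: "diagram D \<Longrightarrow> card (col D c) \<le> Max (col D c)"
  using card_mono[OF _ col_subset_atLeastAtMost_Max[of D c]] by simp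

lemma col_eq_atLeastAtMost:
  assumes "diagram D" "Max (col D c) \<le> card (col D c)"
  shows "col D c = {1..Max (col D c)}"
  using assms card_seteq[OF _ col_subset_atLeastAtMost_Max[of D c]] by simp

section \<open>The largest column to the right, and the height h\<close>

lemma finite_right_cards:
  "diagram D \<Longrightarrow> finite {card (col D c') | c'. c < c' \<and> col D c' \<noteq> {}}"
  by (rule finite_subset[where B = "(\<lambda>c. card (col D c)) ` {c. col D c \<noteq> {}}"])
    (auto intro: finite_imageI finite_nonempty_cols)

lemma card_col_le_max_right:
  "diagram D \<Longrightarrow> c < c' \<Longrightarrow> card (col D c') \<le> max_right D c"
  unfolding max_right_def
  by (cases "col D c' = {}") (auto intro!: Max_ge finite_right_cards)

lemma max_right_leI:
  assumes "diagram D" "\<And>c'. c < c' \<Longrightarrow> col D c' \<noteq> {} \<Longrightarrow> card (col D c') \<le> b"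
  shows "max_right D c \<le> b"
  unfolding max_right_def
  by (rule Max.boundedI) (use assms finite_right_cards in auto)

lemma max_right_antimono: "diagram D \<Longrightarrow> c \<le> c' \<Longrightarrow> max_right D c' \<le> max_right D c"
  by (rule max_right_leI) (auto intro: card_col_le_max_right)

text \<open>Whatever lies to the right of a column attaining \<open>max_right D c\<close> is also
  counted in \<open>max_right D c\<close>, so that column has at least as many cells as any column
  beyond it. Its \<open>h\<close> is therefore its own cell count.\<close>

lemma max_right_attained:
  assumes "diagram D" "0 < max_right D c"
  obtains c' where "c < c'" "col D c' \<noteq> {}" "card (col D c') = max_right D c"
    "max_right D c' \<le> card (col D c')"
proof -
  let ?A = "{c'. c < c' \<and> col D c' \<noteq> {} \<and> card (col D c') = max_right D c}"
  have "max_right D c \<in> insert 0 {card (col D c') | c'. c < c' \<and> col D c' \<noteq> {}}"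
    unfolding max_right_def by (rule Max_in) (use finite_right_cards assms in auto)
  then have ne: "?A \<noteq> {}" using assms by auto
  have fin: "finite ?A" by (rule finite_subset[OF _ finite_nonempty_cols[OF assms(1)]]) auto
  have "Max ?A \<in> ?A" using Max_in[OF fin ne] .
  moreover from this have "max_right D (Max ?A) \<le> max_right D c"
    using max_right_antimono[OF assms(1), of c "Max ?A"] by auto
  ultimately show thesis using that[of "Max ?A"] by simp
qed

text \<open>As m \<le> r, the three cases merge into one formula. It covers empty columns as well,
  whatever \<open>Max {}\<close> is, because m = 0 there.\<close>

lemma h_eq_min:
  "diagram D \<Longrightarrow> h D c = min (Max (col D c)) (max (card (col D c)) (max_right D c))"
  using card_col_le_Max[of D c] by (auto simp: h_def Let_def)

lemma h_le_max_right:
  "diagram D \<Longrightarrow> c < c' \<Longrightarrow> h D c' \<le> max_right D c"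
  using card_col_le_max_right[of D c c'] max_right_antimono[of D c c']
  by (auto simp: h_eq_min)

section \<open>The effect of a single Kohnert move\<close>

lemma kohnert_move_rightmost:
  assumes "diagram D" "(r, c) \<in> D" "\<And>c'. c < c' \<Longrightarrow> (r, c') \<notin> D"
  shows "kohnert_move D r =
    (let E = {r'. 0 < r' \<and> r' < r \<and> (r', c) \<notin> D}
     in if E = {} then D else (D - {(r, c)}) \<union> {(Max E, c)})"
proof -
  have "Max {c. (r, c) \<in> D} = c"
    by (rule Max_eqI) (use assms finite_row in \<open>auto simp: not_less[symmetric]\<close>)
  then show ?thesis using assms(2) by (auto simp: kohnert_move_def Let_def)
qed

text \<open>The landing row is the highest gap below the cell, so no gap is left strictly between
  \<open>p\<close> and \<open>r\<close>. This is what later makes a top drop by exactly one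
  row.\<close>

lemma kohnert_move_rightmost_empty:
  assumes "diagram D" "(r, c) \<in> D" "\<And>c'. c < c' \<Longrightarrow> (r, c') \<notin> D"
    and "0 < q" "q < r" "(q, c) \<notin> D"
  obtains p where "0 < p" "p < r" "(p, c) \<notin> D" "\<And>q. p < q \<Longrightarrow> q < r \<Longrightarrow> (q, c) \<in> D"
    "kohnert_move D r = insert (p, c) (D - {(r, c)})"
proof -
  let ?E = "{r'. 0 < r' \<and> r' < r \<and> (r', c) \<notin> D}"
  have E: "finite ?E" "?E \<noteq> {}" using assms by auto
  have "Max ?E \<in> ?E" using Max_in[OF E] .
  moreover have "(q, c) \<in> D" if "Max ?E < q" "q < r" for q
  proof (rule ccontr)
    assume "(q, c) \<notin> D"
    then have "q \<in> ?E" using that by simp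
    then show False using Max_ge[OF E(1)] that(1) by (meson not_le)
  qed
  moreover have "kohnert_move D r = insert (Max ?E, c) (D - {(r, c)})"
    using kohnert_move_rightmost[OF assms(1-3)] E(2) by (simp only: Let_def if_False) simp
  ultimately show thesis using that[of "Max ?E"] by blast
qed

lemma rightmost_cell:
  assumes "diagram D" "(r, c) \<in> D"
  obtains c' where "c \<le> c'" "(r, c') \<in> D" "\<And>c''. c' < c'' \<Longrightarrow> (r, c'') \<notin> D"
proof
  let ?R = "{c. (r, c) \<in> D}"
  have fin: "finite ?R" by (rule finite_row[OF assms(1)])
  show "c \<le> Max ?R" using fin assms by simp
  show "(r, Max ?R) \<in> D" using Max_in[OF fin] assms by blast
  show "(r, c'') \<notin> D" if "Max ?R < c''" for c''
    using Max_ge[OF fin, of c''] that by auto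
qed

lemma kohnert_move_cases:
  assumes "diagram D"
  obtains "kohnert_move D r = D"
  | c p where "(r, c) \<in> D" "0 < p" "p < r" "(p, c) \<notin> D"
      "kohnert_move D r = insert (p, c) (D - {(r, c)})"
proof (cases "{c. (r, c) \<in> D} = {}")
  case True
  then show thesis using that(1) by (simp add: kohnert_move_def)
next
  case False
  then obtain c where c: "(r, c) \<in> D" "\<And>c'. c < c' \<Longrightarrow> (r, c') \<notin> D"
    using rightmost_cell[OF assms] by blast
  show thesis
  proof (cases "\<exists>q. 0 < q \<and> q < r \<and> (q, c) \<notin> D")
    case True
    then show thesis
      using kohnert_move_rightmost_empty[OF assms c] c(1) that(2) by metis
  next
    case False
    then have "kohnert_move D r = D"
      using kohnert_move_rightmost[OF assms c] by auto
    then show thesis by (rule that(1))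
  qed
qed

lemma col_move_cell:
  "col (insert (p, c) (D - {(r, c)})) k = (if k = c then insert p (col D c - {r}) else col D k)"
  by auto

section \<open>Invariants of Kohnert moves\<close>

lemma diagram_kohnert_move:
  assumes "diagram D"
  shows "diagram (kohnert_move D r)"
  using assms by (cases rule: kohnert_move_cases[where r = r]) (use assms in \<open>auto simp: diagram_def\<close>)

lemma card_col_kohnert_move:
  assumes "diagram D"
  shows "card (col (kohnert_move D r) k) = card (col D k)"
  using assms
proof (cases rule: kohnert_move_cases[where r = r])
  case (2 c p)
  have "card (insert p (col D c - {r})) = card (col D c)"
    using 2 finite_col[OF assms, of c] card_Suc_Diff1[of "col D c" r] by simp
  then show ?thesis by (simp add: 2(5) col_move_cell)
qed simp

lemma col_nonempty_iff_card: "diagram D \<Longrightarrow> col D c \<noteq> {} \<longleftrightarrow> 0 < card (col D c)"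
  by (simp add: finite_col card_gt_0_iff)

lemma Max_col_kohnert_move_le:
  assumes "diagram D" "col D k \<noteq> {}"
  shows "Max (col (kohnert_move D r) k) \<le> Max (col D k)"
  using assms(1)
proof (cases rule: kohnert_move_cases[where r = r])
  case (2 c p)
  have fin: "finite (col D k)" for k by (rule finite_col[OF assms(1)])
  have "p \<le> Max (col D c)"
    using 2 Max_ge[OF fin, of r c] by simp
  then have "Max (insert p (col D c - {r})) \<le> Max (col D c)"
    using fin by (auto intro!: Max.boundedI)
  then show ?thesis by (auto simp: 2(5) col_move_cell)
qed simp

text \<open>The three claims share one induction: bounding the top across a move needs the
  intermediate diagram to be valid and its column nonempty, and the latter follows from the
  preserved cell count.\<close>

lemma KD_invariants:
  assumes "diagram D" "D' \<in> KD D"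
  shows "diagram D'" "card (col D' c) = card (col D c)"
    "col D c \<noteq> {} \<Longrightarrow> Max (col D' c) \<le> Max (col D c)"
proof -
  have "diagram D' \<and> card (col D' c) = card (col D c) \<and>
      (col D c \<noteq> {} \<longrightarrow> Max (col D' c) \<le> Max (col D c))"
    using assms(2)
  proof induction
    case base
    then show ?case using assms(1) by simp
  next
    case (step D' r)
    then show ?case
      using diagram_kohnert_move[of D' r] card_col_kohnert_move[of D' r c]
        Max_col_kohnert_move_le[of D' c r] col_nonempty_iff_card[of D c]
        col_nonempty_iff_card[of D' c] assms(1) by (metis order_trans)
  qed
  then show "diagram D'" "card (col D' c) = card (col D c)"
    "col D c \<noteq> {} \<Longrightarrow> Max (col D' c) \<le> Max (col D c)" by auto
qed

lemma col_nonempty_KD: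
  "diagram D \<Longrightarrow> D' \<in> KD D \<Longrightarrow> col D' c \<noteq> {} \<longleftrightarrow> col D c \<noteq> {}"
  using KD_invariants(1,2)[of D D'] by (simp add: col_nonempty_iff_card)

section \<open>Counting empty cells column by column\<close>

lemma card_empty_cells:
  assumes "diagram D"
  shows "card (empty_cells D) = (\<Sum>c | col D c \<noteq> {}. Max (col D c) - card (col D c))"
proof -
  have "empty_cells D = (\<lambda>(c, r). (r, c)) `
      (SIGMA c : {c. col D c \<noteq> {}}. {1..Max (col D c)} - col D c)" (is "_ = ?f ` ?S")
  proof (intro equalityI subsetI)
    fix x assume "x \<in> empty_cells D"
    then obtain r c r' where *: "x = (r, c)" "0 < r" "(r, c) \<notin> D" "r < r'" "(r', c) \<in> D"
      by (auto simp: empty_cells_def)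
    then have "r' \<le> Max (col D c)" using finite_col[OF assms] by simp
    with * have "(c, r) \<in> ?S" by auto
    then show "x \<in> ?f ` ?S" using *(1) by (auto intro!: image_eqI[where x = "(c, r)"])
  next
    fix x assume "x \<in> ?f ` ?S"
    then obtain y where y: "x = ?f y" "y \<in> ?S" by (rule imageE)
    obtain c r where "y = (c, r)" by (cases y)
    with y have *: "x = (r, c)" "col D c \<noteq> {}" "1 \<le> r" "r \<le> Max (col D c)" "(r, c) \<notin> D"
      by simp_all
    then have "Max (col D c) \<in> col D c" using Max_in finite_col[OF assms] by blast
    then have top: "(Max (col D c), c) \<in> D" by simp
    then have "r \<noteq> Max (col D c)" using *(5) by metis
    then have "r < Max (col D c)" using *(4) by (simp only: le_less simp_thms)
    then have "\<exists>r'>r. (r', c) \<in> D" using top by blast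
    moreover have "0 < c" using diagram_pos[OF assms top] by simp
    ultimately show "x \<in> empty_cells D"
      using *(1,3,5) by (simp add: empty_cells_def Suc_le_eq)
  qed
  moreover have "inj_on ?f ?S" by (auto simp: inj_on_def)
  ultimately have "card (empty_cells D) = card ?S" by (simp add: card_image)
  also have "\<dots> = (\<Sum>c | col D c \<noteq> {}. card ({1..Max (col D c)} - col D c))"
    by (rule card_SigmaI[OF finite_nonempty_cols[OF assms]]) simp
  also have "\<dots> = (\<Sum>c | col D c \<noteq> {}. Max (col D c) - card (col D c))"
    by (simp only: card_Diff_subset[OF finite_col[OF assms] col_subset_atLeastAtMost_Max[OF assms]]
        card_atLeastAtMost diff_Suc_1 Suc_eq_plus1[symmetric])
  finally show ?thesis .
qed

section \<open>Upper bound on the tops of a minimal diagram\<close>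

lemma Max_col_Min_KD_le_h:
  assumes "diagram D" "D' \<in> Min_KD D" "col D c \<noteq> {}"
  shows "Max (col D' c) \<le> h D c"
proof -
  have KD: "D' \<in> KD D" and stuck: "\<And>r. 0 < r \<Longrightarrow> kohnert_move D' r = D'"
    using assms(2) by (auto simp: Min_KD_def)
  note inv = KD_invariants[OF assms(1) KD]
  let ?t = "Max (col D' c)"
  have "col D' c \<noteq> {}" using col_nonempty_KD[OF assms(1) KD] assms(3) by blast
  then have t: "(?t, c) \<in> D'" using Max_in[OF finite_col[OF inv(1)]] by (metis mem_col)
  obtain c' where c': "c \<le> c'" "(?t, c') \<in> D'" "\<And>c''. c' < c'' \<Longrightarrow> (?t, c'') \<notin> D'"
    using rightmost_cell[OF inv(1) t] by blast
  \<comment> \<open>A gap below the rightmost cell of row \<open>?t\<close> would let the move at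
    that row change \<open>D'\<close>.\<close>
  have full: "(q, c') \<in> D'" if q_pos: "0 < q" and q_lt: "q < ?t" for q
  proof (rule ccontr)
    assume q: "(q, c') \<notin> D'"
    obtain p where "(p, c') \<notin> D'" "kohnert_move D' ?t = insert (p, c') (D' - {(?t, c')})"
      using kohnert_move_rightmost_empty[OF inv(1) c'(2,3) q_pos q_lt q] by metis
    moreover have "0 < ?t" using q_lt by simp
    ultimately show False using stuck[of ?t] by auto
  qed
  have "{1..?t} \<subseteq> col D' c'"
    using full c'(2) by (auto simp: Suc_le_eq le_less)
  from card_mono[OF finite_col[OF inv(1)] this] have "?t \<le> card (col D c')"
    by (simp add: inv(2))
  \<comment> \<open>The full column is either \<open>c\<close> itself, which bounds
    \<open>?t\<close> by m, or further right, which bounds it by M.\<close>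
  then have "?t \<le> max (card (col D c)) (max_right D c)"
    using card_col_le_max_right[OF assms(1), of c c'] c'(1)
    by (cases "c = c'") auto
  then show ?thesis using inv(3)[OF assms(3)] by (simp add: h_eq_min[OF assms(1)])
qed

section \<open>Lowering the tops to height h\<close>

lemma Max_col_kohnert_move_top:
  assumes "diagram D" "col D c \<noteq> {}" "card (col D c) < Max (col D c)"
    and "\<And>c'. c < c' \<Longrightarrow> (Max (col D c), c') \<notin> D"
  shows "Max (col (kohnert_move D (Max (col D c))) c) = Max (col D c) - 1"
    and "k \<noteq> c \<Longrightarrow> col (kohnert_move D (Max (col D c))) k = col D k"
proof -
  let ?t = "Max (col D c)"
  have fin: "finite (col D c)" by (rule finite_col[OF assms(1)])
  have t: "(?t, c) \<in> D" using Max_in[OF fin assms(2)] by simp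
  \<comment> \<open>Fewer cells than rows up to the top, so some row has a gap.\<close>
  have "\<not> {1..?t} \<subseteq> col D c"
    using card_mono[OF fin, of "{1..?t}"] assms(3) by auto
  then obtain q where "1 \<le> q" "q \<le> ?t" "(q, c) \<notin> D"
    by (metis atLeastAtMost_iff mem_col subsetI)
  then have q: "0 < q" "q < ?t" "(q, c) \<notin> D" using t by (auto simp: le_less)
  obtain p where p: "0 < p" "p < ?t" "(p, c) \<notin> D" "\<And>q. p < q \<Longrightarrow> q < ?t \<Longrightarrow> (q, c) \<in> D"
    "kohnert_move D ?t = insert (p, c) (D - {(?t, c)})"
    using kohnert_move_rightmost_empty[OF assms(1) t assms(4) q] by metis
  show "k \<noteq> c \<Longrightarrow> col (kohnert_move D ?t) k = col D k"
    by (simp add: p(5) col_move_cell)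
  \<comment> \<open>Row \<open>?t - 1\<close> was occupied already or is itself the highest gap,
    where the cell lands.\<close>
  have "?t - 1 \<in> insert p (col D c - {?t})"
    using p(2) p(4)[of "?t - 1"] by (cases "p = ?t - 1") auto
  moreover have "y \<le> ?t - 1" if "y \<in> insert p (col D c - {?t})" for y
    using that p(2) Max_ge[OF fin, of y] by auto
  ultimately have "Max (insert p (col D c - {?t})) = ?t - 1"
    using fin by (intro Max_eqI) auto
  then show "Max (col (kohnert_move D ?t) c) = ?t - 1"
    by (simp add: p(5) col_move_cell)
qed

lemma KD_lower_col:
  assumes "diagram D" "D' \<in> KD D" "col D k \<noteq> {}"
    and "\<And>c. k < c \<Longrightarrow> col D c \<noteq> {} \<Longrightarrow> Max (col D' c) = h D c"
    and "h D k \<le> Max (col D' k)"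
  shows "\<exists>E \<in> KD D. Max (col E k) = h D k \<and> (\<forall>c. c \<noteq> k \<longrightarrow> col E c = col D' c)"
  using assms(2,4,5)
proof (induction "Max (col D' k) - h D k" arbitrary: D')
  case 0
  then show ?case by (intro bexI[of _ D']) auto
next
  case (Suc n)
  let ?t = "Max (col D' k)"
  let ?E = "kohnert_move D' ?t"
  note inv = KD_invariants[OF assms(1) Suc.prems(1)]
  have lt: "h D k < ?t" using Suc.hyps(2) by simp
  \<comment> \<open>The top never exceeds its original row, so \<open>h\<close> lies below that row
    and the minimum defining it is attained by max m M.\<close>
  then have bnd: "card (col D k) < ?t" "max_right D k < ?t"
    using inv(3)[OF assms(3)] by (auto simp: h_eq_min[OF assms(1)])
  have ne: "col D' k \<noteq> {}" using col_nonempty_KD[OF assms(1) Suc.prems(1)] assms(3) by blast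
  \<comment> \<open>Columns further right already have top \<open>h D c\<close>, which is at most M
    and hence below \<open>?t\<close>; so the top cell of column \<open>k\<close> is the one that
    moves.\<close>
  have right: "(?t, c) \<notin> D'" if "k < c" for c
  proof
    assume t: "(?t, c) \<in> D'"
    then have "col D c \<noteq> {}"
      using col_nonempty_KD[OF assms(1) Suc.prems(1), of c] by auto
    moreover have "?t \<le> Max (col D' c)" using t finite_col[OF inv(1)] by simp
    ultimately show False
      using Suc.prems(2)[OF that] h_le_max_right[OF assms(1) that] bnd(2) by simp
  qed
  have "card (col D' k) < ?t" using bnd(1) by (simp add: inv(2))
  note top = Max_col_kohnert_move_top[OF inv(1) ne this right]
  have "?E \<in> KD D" using lt Suc.prems(1) by (intro KD.step) auto
  moreover have "n = Max (col ?E k) - h D k" using Suc.hyps(2) top(1) by simp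
  moreover have "Max (col ?E c) = h D c" if "k < c" "col D c \<noteq> {}" for c
    using Suc.prems(2)[OF that] top(2)[of c] that(1) by simp
  moreover have "h D k \<le> Max (col ?E k)" using lt top(1) by simp
  ultimately obtain E where "E \<in> KD D" "Max (col E k) = h D k" "\<forall>c. c \<noteq> k \<longrightarrow> col E c = col ?E c"
    using Suc.hyps(1)[of ?E] by blast
  then show ?case using top(2) by auto
qed

text \<open>Downward induction on \<open>k\<close> from beyond the last nonempty column. Keeping the
  columns left of \<open>k\<close> untouched ensures that each one starts from its original top,
  which is at least \<open>h\<close>.\<close>

lemma KD_with_tops_h_above:
  assumes "diagram D"
  shows "\<exists>D' \<in> KD D. (\<forall>c < k. col D' c = col D c) \<and>
           (\<forall>c \<ge> k. col D c \<noteq> {} \<longrightarrow> Max (col D' c) = h D c)"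
proof -
  obtain b where b: "\<And>c. col D c \<noteq> {} \<Longrightarrow> c < b"
    using finite_nonempty_cols[OF assms] by (auto simp: finite_nat_set_iff_bounded)
  show ?thesis
  proof (cases "k \<le> b")
    case False
    with b show ?thesis using KD.base by (metis not_le order.strict_trans2 order.asym)
  next
    case True
    then show ?thesis
    proof (induction k rule: inc_induct)
      case base
      then show ?case using b KD.base by (metis not_le)
    next
      case (step k)
      then obtain D' where D': "D' \<in> KD D" "\<forall>c < Suc k. col D' c = col D c"
        "\<forall>c \<ge> Suc k. col D c \<noteq> {} \<longrightarrow> Max (col D' c) = h D c" by blast
      show ?case
      proof (cases "col D k = {}")
        case True
        with D' show ?thesis by (metis less_Suc_eq not_less_eq_eq le_antisym)
      next
        case False
        have "h D k \<le> Max (col D' k)" using D'(2) by (simp add: h_eq_min[OF assms])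
        then obtain E where E: "E \<in> KD D" "Max (col E k) = h D k"
          "\<forall>c. c \<noteq> k \<longrightarrow> col E c = col D' c"
          using KD_lower_col[OF assms D'(1) False] D'(3) by (metis Suc_leI)
        have "Max (col E c) = h D c" if "k \<le> c" "col D c \<noteq> {}" for c
          using that E(2,3) D'(3) by (cases "c = k") auto
        moreover have "col E c = col D c" if "c < k" for c
          using that E(3) D'(2) by simp
        ultimately show ?thesis using E(1) by blast
      qed
    qed
  qed
qed

section \<open>Minimality of the lowered diagram\<close>

lemma tops_h_imp_Min_KD:
  assumes "diagram D" "D' \<in> KD D"
    and top: "\<And>c. col D c \<noteq> {} \<Longrightarrow> Max (col D' c) = h D c"
  shows "D' \<in> Min_KD D"
proof -
  note inv = KD_invariants[OF assms(1,2)]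
  \<comment> \<open>The top row \<open>h D c\<close> cannot be less than the number of cells, so
    equality holds and there is no gap.\<close>
  have full: "col D' c = {1..card (col D c)}"
    if "col D c \<noteq> {}" "h D c \<le> card (col D c)" for c
  proof -
    have "Max (col D' c) = card (col D c)"
      using card_col_le_Max[OF inv(1), of c] top[OF that(1)] that(2) by (simp add: inv(2))
    then show ?thesis using col_eq_atLeastAtMost[OF inv(1), of c] inv(2)[of c] by (metis order_refl)
  qed
  have below: "(q, c) \<in> D'"
    if rc: "(r, c) \<in> D'" "\<And>c'. c < c' \<Longrightarrow> (r, c') \<notin> D'" and q: "0 < q" "q < r" for r c q
  proof -
    have ne: "col D c \<noteq> {}"
      using rc(1) col_nonempty_KD[OF assms(1,2), of c] by auto
    \<comment> \<open>Otherwise a column to the right that fills rows 1 to M has a cell in row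
      \<open>r\<close>, so \<open>(r, c)\<close> is not rightmost.\<close>
    have "max_right D c < r"
    proof (rule ccontr)
      assume r: "\<not> max_right D c < r"
      then have "0 < max_right D c" using q by simp
      then obtain c' where c': "c < c'" "col D c' \<noteq> {}" "card (col D c') = max_right D c"
        "max_right D c' \<le> card (col D c')" using max_right_attained[OF assms(1)] by blast
      then have "col D' c' = {1..max_right D c}"
        using full[of c'] by (simp add: h_eq_min[OF assms(1)])
      then have "r \<in> col D' c'" using r q by auto
      then show False using rc(2)[OF c'(1)] by simp
    qed
    moreover have r: "r \<le> h D c"
      using rc(1) finite_col[OF inv(1)] top[OF ne] by (metis Max_ge mem_col)
    \<comment> \<open>From M < r \<le> h \<le> max m M it follows that M < m, so column
      \<open>c\<close> is full.\<close>
    ultimately have "h D c \<le> card (col D c)" using h_eq_min[OF assms(1), of c] by linarith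
    then have "q \<in> col D' c" using full[OF ne] r q by simp
    then show ?thesis by simp
  qed
  have "kohnert_move D' r = D'" for r
  proof (cases "{c. (r, c) \<in> D'} = {}")
    case True
    then show ?thesis by (simp add: kohnert_move_def)
  next
    case False
    then obtain c where c: "(r, c) \<in> D'" "\<And>c'. c < c' \<Longrightarrow> (r, c') \<notin> D'"
      using rightmost_cell[OF inv(1)] by blast
    have "{r'. 0 < r' \<and> r' < r \<and> (r', c) \<notin> D'} = {}"
      using below[OF c] by blast
    then show ?thesis using kohnert_move_rightmost[OF inv(1) c] by simp
  qed
  then show ?thesis using assms(2) by (simp add: Min_KD_def)
qed

section \<open>The maximal number of empty cells\<close>

lemma Max_card_empty_cells_Min_KD:
  assumes "diagram D"
  shows "Max {card (empty_cells D') | D'. D' \<in> Min_KD D}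
    = (\<Sum>c | col D c \<noteq> {}. h D c - card (col D c))" (is "Max ?A = ?S")
proof (rule Max_eqI)
  have card: "card (empty_cells D') = (\<Sum>c | col D c \<noteq> {}. Max (col D' c) - card (col D c))"
    if "D' \<in> KD D" for D'
    using card_empty_cells[OF KD_invariants(1)[OF assms that]]
    by (simp add: col_nonempty_KD[OF assms that, simplified] KD_invariants(2)[OF assms that])
  show le: "x \<le> ?S" if "x \<in> ?A" for x
  proof -
    from that obtain D' where D': "x = card (empty_cells D')" "D' \<in> Min_KD D" by blast
    then have "D' \<in> KD D" by (simp add: Min_KD_def)
    then show ?thesis
      unfolding D'(1) card[OF \<open>D' \<in> KD D\<close>]
      by (intro sum_mono diff_le_mono) (auto intro: Max_col_Min_KD_le_h[OF assms D'(2)])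
  qed
  \<comment> \<open>The bound just shown makes this set of naturals finite, without any appeal to
    finiteness of \<open>KD D\<close>.\<close>
  show "finite ?A"
    by (rule finite_subset[of _ "{..?S}"]) (use le in auto)
  obtain D' where D': "D' \<in> KD D" "\<And>c. col D c \<noteq> {} \<Longrightarrow> Max (col D' c) = h D c"
    using KD_with_tops_h_above[OF assms, of 0] by auto
  have "card (empty_cells D') = ?S" unfolding card[OF D'(1)] using D'(2) by simp
  then show "?S \<in> ?A" using tops_h_imp_Min_KD[OF assms D'] by (metis (mono_tags, lifting) mem_Collect_eq)
qed

theorem theorem4p6:
  fixes D :: "(nat \<times> nat) set" and n :: nat and c N :: "nat \<Rightarrow> nat"
  assumes "diagram D"
    and "strict_mono_on {1..n} c"
    and "c ` {1..n} = {j. col D j \<noteq> {}}"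
    and "\<And>i. i \<in> {1..n} \<Longrightarrow> N i = card (col D (c i))"
  shows "int (Max {card (empty_cells D') | D'. D' \<in> Min_KD D})
           = (\<Sum>i = 1..n. int (h D (c i)) - int (N i))"
proof -
  \<comment> \<open>With this, the truncated differences of naturals agree with the integer
    differences.\<close>
  have le: "card (col D j) \<le> h D j" for j
    using card_col_le_Max[OF assms(1)] by (simp add: h_eq_min[OF assms(1)])
  have inj: "inj_on c {1..n}" using assms(2) by (rule strict_mono_on_imp_inj_on)
  have "int (Max {card (empty_cells D') | D'. D' \<in> Min_KD D})
      = (\<Sum>j \<in> c ` {1..n}. int (h D j) - int (card (col D j)))"
    unfolding assms(3) by (simp add: Max_card_empty_cells_Min_KD[OF assms(1)] of_nat_diff le)
  also have "\<dots> = (\<Sum>i = 1..n. int (h D (c i)) - int (N i))"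
    by (subst sum.reindex[OF inj]) (simp add: assms(4))
  finally show ?thesis .
qed

end
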